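(* Let $\varphi$ be a finite measure on the unit circle $\mathbb{T}$, let $1\le m<n$ be integers, and assume $D_k[\varphi]\ne 0$ for $n-m\le k\le n$. For complex numbers $z_1,\dots,z_m$ let $T_n[\varphi;z_1,\dots,z_m]$ be the $n\times n$ multi-bordered Toeplitz determinant $$T_n[\varphi;z_1,\dots,z_m]:=\det\begin{pmatrix}\varphi_0&\varphi_1&\cdots&\varphi_{n-m-1}&1&1&\cdots&1\\ \varphi_{-1}&\varphi_0&\cdots&\varphi_{n-m-2}&z_1&z_2&\cdots&z_m\\ \vdots&\vdots&\ddots&\vdots&\vdots&\vdots&\ddots&\vdots\\ \varphi_{-n+1}&\varphi_{-n+2}&\cdots&\varphi_{-m}&z_1^{n-1}&z_2^{n-1}&\cdots&z_m^{n-1}\end{pmatrix}.$$ Then $$T_n[\varphi;z_1,\dots,z_m]=\sqrt{D_{n-m}[\varphi]\,D_{n-m+1}[\varphi]}\;\det\begin{pmatrix}Q_{n-m}(z_1)&\cdots&Q_{n-m}(z_m)\\ \vdots&\ddots&\vdots\\ Q_{n-1}(z_1)&\cdots&Q_{n-1}(z_m)\end{pmatrix}$$ and $$T_n[\tilde\varphi;z_1,\dots,z_m]=\sqrt{D_{n-m}[\varphi]\,D_{n-m+1}[\varphi]}\;\det\begin{pmatrix}\widehat Q_{n-m}(z_1)&\cdots&\widehat Q_{n-m}(z_m)\\ \vdots&\ddots&\vdots\\ \widehat Q_{n-1}(z_1)&\cdots&\widehat Q_{n-1}(z_m)\end{pmatrix},$$ where $Q_k$ and $\widehat Q_k$ are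 the biorthonormal polynomials on the unit circle associated with $\varphi$, and the measures $\varphi$ and $\tilde\varphi$ are related by $\mathrm{d}\tilde\varphi(z):=\mathrm{d}\varphi(z^{-1})$.
   Context: Fourier coefficients of a finite measure $\varphi$ on the unit circle $\mathbb{T}$: $\varphi_j=\int_{\mathbb{T}}\zeta^{-j}\,\mathrm{d}\varphi(\zeta)$, $j\in\mathbb{Z}$. Toeplitz determinants: $D_k[\varphi]=\det(\varphi_{i-j})_{0\le i,j\le k-1}$. The measure $\tilde\varphi$ is the image of $\varphi$ under $z\mapsto z^{-1}$, so $\tilde\varphi_j=\varphi_{-j}$. The biorthonormal polynomials on the unit circle, which satisfy $\int_{\mathbb{T}}Q_j(z)\widehat Q_k(z^{-1})\,\mathrm{d}\varphi(z)=\delta_{jk}$, are given, whenever $D_k[\varphi],D_{k+1}[\varphi]\neq0$, by $$Q_k(z)=\frac{1}{\sqrt{D_k[\varphi]D_{k+1}[\varphi]}}\det\begin{pmatrix}\varphi_0&\varphi_{-1}&\cdots&\varphi_{-k}\\ \varphi_1&\varphi_0&\cdots&\varphi_{-k+1}\\ \vdots&\vdots&\ddots&\vdots\\ \varphi_{k-1}&\varphi_{k-2}&\cdots&\varphi_{-1}\\ 1&z&\cdots&z^k\end{pmatrix},\qquad \widehat Q_k(z)=\frac{1}{\sqrt{D_k[\varphi]D_{k+1}[\varphi]}}\det\begin{pmatrix}\varphi_0&\varphi_{-1}&\cdots&\varphi_{-k+1}&1\\ \varphi_1&\varphi_0&\cdots&\varphi_{-k+2}&z\\ \vdots&\vdots&\ddots&\vdots&\vdots\\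 \varphi_k&\varphi_{k-1}&\cdots&\varphi_1&z^k\end{pmatrix}.$$
   Formalization: In both formulas the prefactor is corrected to the square root of D_{n-m}[φ] D_n[φ] instead of D_{n-m}[φ] D_{n-m+1}[φ]; the printed version fails for m ≥ 2 (e.g. φ twice normalized arc length, n=3, m=2) and agrees for m=1. *)

theory Defs
  imports "HOL-Analysis.Bochner_Integration" "Jordan_Normal_Form.Determinant"
begin

definition circle_borel :: "complex measure" where
  "circle_borel = restrict_space borel (sphere 0 1)"

definition finite_circle_measure :: "complex measure \<Rightarrow> bool" where
  "finite_circle_measure \<phi> \<longleftrightarrow> finite_measure \<phi> \<and> sets \<phi> = sets circle_borel"

definition fourier_coeff :: "complex measure \<Rightarrow> int \<Rightarrow> complex" where
  "fourier_coeff \<phi> j = (LINT \<zeta>|\<phi>. \<zeta> powi (- j))"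

definition toeplitz_det :: "complex measure \<Rightarrow> nat \<Rightarrow> complex" where
  "toeplitz_det \<phi> k =
     Determinant.det (mat k k (\<lambda>(i, j). fourier_coeff \<phi> (int i - int j)))"

definition reflected_measure :: "complex measure \<Rightarrow> complex measure" where
  "reflected_measure \<phi> = distr \<phi> circle_borel inverse"

text \<open>
  For a (nonnegative) measure all Toeplitz determinants are nonnegative reals. Hence under the
  radicals below the principal branch \<^const>\<open>csqrt\<close> is the usual nonnegative square root.
\<close>

definition biorth_Q :: "complex measure \<Rightarrow> nat \<Rightarrow> complex \<Rightarrow> complex" where
  "biorth_Q \<phi> k z =
     1 / csqrt (toeplitz_det \<phi> k * toeplitz_det \<phi> (k + 1)) *
     Determinant.det (mat (k + 1) (k + 1)
       (\<lambda>(i, j). if i < k then fourier_coeff \<phi> (int i - int j) else z ^ j))"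

definition biorth_Q_hat :: "complex measure \<Rightarrow> nat \<Rightarrow> complex \<Rightarrow> complex" where
  "biorth_Q_hat \<phi> k z =
     1 / csqrt (toeplitz_det \<phi> k * toeplitz_det \<phi> (k + 1)) *
     Determinant.det (mat (k + 1) (k + 1)
       (\<lambda>(i, j). if j < k then fourier_coeff \<phi> (int i - int j) else z ^ i))"

text \<open>
  The points \<open>z\<^sub>1, \<dots>, z\<^sub>m\<close> are \<open>z 0, \<dots>, z (m - 1)\<close>; matrix indices also start at 0. Note the
  index difference \<open>j - i\<close>, in contrast to \<open>i - j\<close> in \<^const>\<open>toeplitz_det\<close>.
\<close>

definition multi_bordered_det ::
    "nat \<Rightarrow> nat \<Rightarrow> complex measure \<Rightarrow> (nat \<Rightarrow> complex) \<Rightarrow> complex" where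
  "multi_bordered_det n m \<phi> z =
     Determinant.det (mat n n
       (\<lambda>(i, j). if j < n - m then fourier_coeff \<phi> (int j - int i) else z (j - (n - m)) ^ i))"

end

theory Submission
  imports Defs "Jordan_Normal_Form.Char_Poly" "HOL-Library.Nonpos_Ints"
begin

text \<open>
  Expanding the determinant for \<open>Q\<^sub>k\<close> along its last row exhibits it as a combination of the entries
  of that row, whose coefficients do not depend on the row and whose last coefficient is \<open>D\<^sub>k\<close>, before
  normalization. Inserting an earlier row gives 0. Hence, after transposition, replacing the columns
  \<open>k = n - m, \<dots>, n - 1\<close> of the multi-bordered matrix by these combinations makes it block triangular,
  with diagonal blocks the Toeplitz matrix of size \<open>n - m\<close> and the matrix of the \<open>Q\<^sub>k (z\<^sub>j)\<close>. This
  multiplies the determinant by the telescoping product of the \<open>D\<^sub>k / sqrt (D\<^sub>k D\<^sub>k\<^sub>+\<^sub>1)\<close>. The square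
  roots combine without sign ambiguity because \<open>D\<^sub>k \<ge> 0\<close>: the Toeplitz matrices are positive
  semidefinite. Passing to the reflected measure transposes the Toeplitz matrices, which turns \<open>Q\<^sub>k\<close>
  into its dual.
\<close>

section \<open>Bordered determinants over commutative rings\<close>

text \<open>Cofactors along the last row do not see that row. Taking them from the matrix with last
  row zero makes the coefficients \<open>C k j\<close> visibly independent of
  \<open>r\<close>.\<close>

lemma det_bordered_expand:
  fixes a :: "nat \<Rightarrow> nat \<Rightarrow> 'a :: comm_ring_1"
  defines "C \<equiv> \<lambda>k j. cofactor (mat (Suc k) (Suc k) (\<lambda>(i, j). if i < k then a i j else 0)) k j"
  shows "det (mat (Suc k) (Suc k) (\<lambda>(i, j). if i < k then a i j else r j)) =
           (\<Sum>j<Suc k. r j * C k j)"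
    and "C k k = det (mat k k (\<lambda>(i, j). a i j))"
proof -
  let ?M = "mat (Suc k) (Suc k) (\<lambda>(i, j). if i < k then a i j else r j)"
  have del: "mat_delete ?M k j =
      mat_delete (mat (Suc k) (Suc k) (\<lambda>(i, j). if i < k then a i j else 0)) k j" for j
    by (rule eq_matI) (auto simp: mat_delete_def)
  have "det ?M = (\<Sum>j<Suc k. ?M $$ (k, j) * cofactor ?M k j)"
    by (rule laplace_expansion_row) auto
  also have "\<dots> = (\<Sum>j<Suc k. r j * C k j)"
    by (rule sum.cong) (auto simp: C_def cofactor_def del)
  finally show "det ?M = (\<Sum>j<Suc k. r j * C k j)" .
  have "mat_delete (mat (Suc k) (Suc k) (\<lambda>(i, j). if i < k then a i j else 0)) k k =
      mat k k (\<lambda>(i, j). a i j)"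
    by (rule eq_matI) (auto simp: mat_delete_def)
  then show "C k k = det (mat k k (\<lambda>(i, j). a i j))"
    by (simp add: C_def cofactor_def)
qed

text \<open>Two evaluations of \<open>det (B * U)\<close>, with \<open>B\<close> the bordered matrix
  and \<open>U\<close> a triangular change of columns. The weights \<open>c\<close> stay free, so
  that square roots enter only later, and nothing is divided, so that vanishing minors are
  harmless.\<close>

lemma det_multi_bordered:
  fixes a w :: "nat \<Rightarrow> nat \<Rightarrow> 'a :: idom" and c :: "nat \<Rightarrow> 'a"
  shows "det (mat (p + m) (p + m) (\<lambda>(i, j). if i < p then a i j else w (i - p) j)) *
           (\<Prod>k=p..<p + m. c k * det (mat k k (\<lambda>(i, j). a i j))) =
         det (mat p p (\<lambda>(i, j). a i j)) *
           det (mat m m (\<lambda>(i, j). c (p + i) *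
             det (mat (Suc (p + i)) (Suc (p + i))
               (\<lambda>(r, s). if r < p + i then a r s else w j s))))"
proof -
  define C where "C \<equiv> \<lambda>k j. cofactor (mat (Suc k) (Suc k) (\<lambda>(i, j). if i < k then a i j else 0)) k j"
  define D where "D = (\<lambda>k. det (mat k k (\<lambda>(i, j). a i j)))"
  define P where "P = (\<lambda>k r. det (mat (Suc k) (Suc k) (\<lambda>(i, j). if i < k then a i j else r j)))"
  define B where "B = mat (p + m) (p + m) (\<lambda>(i, j). if i < p then a i j else w (i - p) j)"
  \<comment> \<open>Columns below \<open>p\<close> are unit vectors and leave the Toeplitz part
    unchanged. Column \<open>k \<ge> p\<close> holds the expansion coefficients, so multiplying a
    row \<open>r\<close> by it gives \<open>c k * P k r\<close>.\<close>
  define u where "u = (\<lambda>j k. if k < p then of_bool (j = k) else if j \<le> k then c k * C k j else 0)"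
  define U where "U = mat (p + m) (p + m) (\<lambda>(j, k). u j k)"
  define W where "W = mat m m (\<lambda>(i, j). c (p + j) * P (p + j) (w i))"
  have P_expand: "P k r = (\<Sum>j<Suc k. r j * C k j)" and C_diag: "C k k = D k" for k r
    unfolding P_def C_def D_def by (rule det_bordered_expand)+
  have orth: "P k (a i) = 0" if "i < k" for i k
    unfolding P_def
    by (rule det_identical_rows[of _ "Suc k" i k]) (use that in \<open>auto intro!: eq_vecI\<close>)
  have upper: "upper_triangular U"
    unfolding upper_triangular_def by (auto simp: U_def u_def)
  have "det U = prod_list (diag_mat U)"
    by (rule det_upper_triangular[OF upper, of "p + m"]) (simp add: U_def)
  also have "\<dots> = (\<Prod>k=0..<p + m. U $$ (k, k))"
    by (simp add: prod_list_diag_prod U_def)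
  also have "\<dots> = (\<Prod>k=0..<p + m. u k k)"
    by (simp add: U_def)
  also have "\<dots> = (\<Prod>k=0..<p. u k k) * (\<Prod>k=p..<p + m. u k k)"
    by (rule prod.atLeastLessThan_concat[symmetric]) auto
  also have "(\<Prod>k=0..<p. u k k) = 1"
    by (rule prod.neutral) (auto simp: u_def)
  also have "(\<Prod>k=p..<p + m. u k k) = (\<Prod>k=p..<p + m. c k * D k)"
    by (rule prod.cong) (auto simp: u_def C_diag)
  finally have detU: "det U = (\<Prod>k=p..<p + m. c k * D k)" by simp
  have col: "(\<Sum>j<p + m. r j * u j k) = (if k < p then r k else c k * P k r)"
    if "k < p + m" for r k
  proof (cases "k < p")
    case True
    have "(\<Sum>j<p + m. r j * u j k) = (\<Sum>j<p + m. if j = k then r k else 0)"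
      using True by (intro sum.cong) (auto simp: u_def)
    then show ?thesis using True that by simp
  next
    case False
    have "(\<Sum>j<p + m. r j * u j k) = (\<Sum>j<Suc k. r j * u j k)"
      using False that by (intro sum.mono_neutral_right) (auto simp: u_def)
    also have "\<dots> = (\<Sum>j<Suc k. c k * (r j * C k j))"
      using False by (intro sum.cong) (auto simp: u_def)
    also have "\<dots> = c k * P k r"
      unfolding P_expand by (rule sum_distrib_left[symmetric])
    finally show ?thesis using False by simp
  qed
  have "B * U = four_block_mat (mat p p (\<lambda>(i, j). a i j)) (0\<^sub>m p m) (mat m p (\<lambda>(i, j). w i j)) W"
    (is "_ = ?R")
  proof (rule eq_matI)
    fix i k assume "i < dim_row ?R" "k < dim_col ?R"
    then have i: "i < p + m" and k: "k < p + m" by (auto simp: W_def)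
    have "(B * U) $$ (i, k) =
        (\<Sum>j<p + m. (if i < p then a i j else w (i - p) j) * u j k)"
      using i k by (auto simp: B_def U_def scalar_prod_def atLeast0LessThan intro!: sum.cong)
    also have "\<dots> = (if k < p then (if i < p then a i k else w (i - p) k)
        else c k * P k (if i < p then a i else w (i - p)))"
      using col[OF k, of "if i < p then a i else w (i - p)"] by (auto split: if_splits)
    \<comment> \<open>In the upper right block \<open>i < p \<le> k\<close>, so \<open>orth\<close>
      applies and the entry vanishes.\<close>
    finally show "(B * U) $$ (i, k) = ?R $$ (i, k)"
      using i k by (auto simp: W_def orth)
  qed (auto simp: B_def U_def W_def)
  then have "det (B * U) = D p * det W"
    unfolding D_def by (simp only:) (rule det_four_block_mat_upper_right_zero, auto simp: W_def)
  moreover have "det (B * U) = det B * det U"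
    by (rule det_mult) (auto simp: B_def U_def)
  moreover have "det W = det (transpose_mat W)"
    by (rule det_transpose[of _ m, symmetric]) (simp add: W_def)
  moreover have "transpose_mat W = mat m m (\<lambda>(i, j). c (p + i) * P (p + i) (w j))"
    by (rule eq_matI) (auto simp: W_def)
  ultimately show ?thesis
    using detU by (simp add: B_def D_def P_def)
qed

section \<open>Determinants of positive semidefinite matrices\<close>

text \<open>The characteristic polynomial splits over the complex numbers, so the determinant is the
  product of the eigenvalues. At an eigenvector the form equals the eigenvalue times a positive
  squared norm.\<close>

lemma det_psd_nonneg:
  fixes A :: "complex mat"
  assumes A: "A \<in> carrier_mat n n"
    and psd: "\<And>v. v \<in> carrier_vec n \<Longrightarrow> (\<Sum>i<n. cnj (v $ i) * (A *\<^sub>v v) $ i) \<in> \<real>\<^sub>\<ge>\<^sub>0"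
  shows "det A \<in> \<real>\<^sub>\<ge>\<^sub>0"
proof -
  obtain es where es: "char_poly A = (\<Prod>e\<leftarrow>es. [:- e, 1:])" and len: "length es = n"
    using char_poly_factorized[OF A] by blast
  have pos: "e \<in> \<real>\<^sub>\<ge>\<^sub>0" if "e \<in> set es" for e
  proof -
    have "poly (char_poly A) e = 0"
      using that by (auto simp: es poly_prod_list prod_list_zero_iff)
    then obtain v where v: "eigenvector A v e"
      using eigenvalue_root_char_poly[OF A] by (auto simp: eigenvalue_def)
    then have vc: "v \<in> carrier_vec n" and v0: "v \<noteq> 0\<^sub>v n" and Av: "A *\<^sub>v v = e \<cdot>\<^sub>v v"
      using A by (auto simp: eigenvector_def)
    define s where "s = (\<Sum>i<n. (cmod (v $ i))\<^sup>2)"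
    obtain i where i: "i < n" "v $ i \<noteq> 0"
      using v0 vc by (metis eq_vecI carrier_vecD index_zero_vec(1) index_zero_vec(2))
    have "0 < (cmod (v $ i))\<^sup>2" using i by simp
    also have "\<dots> \<le> s"
      unfolding s_def by (rule member_le_sum) (use i in auto)
    finally have s: "0 < s" .
    have "(\<Sum>i<n. cnj (v $ i) * (A *\<^sub>v v) $ i) = (\<Sum>i<n. e * of_real ((cmod (v $ i))\<^sup>2))"
      using vc by (intro sum.cong) (auto simp: Av complex_norm_square mult_ac simp del: of_real_power)
    also have "\<dots> = e * of_real s"
      by (simp add: s_def sum_distrib_left)
    finally have "e * of_real s \<in> \<real>\<^sub>\<ge>\<^sub>0" using psd[OF vc] by simp
    then have "(e * of_real s) * of_real (1 / s) \<in> \<real>\<^sub>\<ge>\<^sub>0"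
      by (rule nonneg_Reals_mult_I) (use s in \<open>simp only: nonneg_Reals_of_real_iff, simp\<close>)
    moreover have "(e * of_real s) * of_real (1 / s) = e" using s by simp
    ultimately show ?thesis by (simp only:)
  qed
  \<comment> \<open>At 0 the characteristic polynomial gives \<open>det (- A)\<close> and also the
    product of the negated eigenvalues; the signs cancel.\<close>
  have "(- 1) ^ n * det A = det (- A)"
  proof -
    have "- A = (- 1) \<cdot>\<^sub>m A" by (rule eq_matI) auto
    then show ?thesis using A by simp
  qed
  also have "\<dots> = poly (char_poly A) 0"
  proof -
    have "char_matrix A 0 = A" using A by (auto simp: char_matrix_def intro!: eq_matI)
    then show ?thesis by (simp add: char_poly_matrix[OF A])
  qed
  also have "\<dots> = (\<Prod>e\<leftarrow>es. - e)"
    by (simp add: es poly_prod_list comp_def)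
  also have "\<dots> = (- 1) ^ length es * prod_list es"
    by (induction es) auto
  finally have "det A = prod_list es" by (simp add: len)
  moreover have "prod_list xs \<in> \<real>\<^sub>\<ge>\<^sub>0" if "set xs \<subseteq> \<real>\<^sub>\<ge>\<^sub>0" for xs :: "complex list"
    using that by (induction xs) auto
  ultimately show ?thesis using pos by auto
qed

section \<open>Toeplitz determinants of a finite circle measure\<close>

context
  fixes \<phi> :: "complex measure"
  assumes fin: "finite_circle_measure \<phi>"
begin

lemma space_circle_measure: "space \<phi> = sphere 0 1"
  using fin sets_eq_imp_space_eq[of \<phi> circle_borel]
  by (simp add: finite_circle_measure_def circle_borel_def space_restrict_space)

lemma measurable_on_circle:
  "continuous_on (sphere 0 1) f \<Longrightarrow> f \<in> borel_measurable \<phi>"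
  for f :: "complex \<Rightarrow> 'a :: topological_space"
  using borel_measurable_continuous_on_restrict[of "sphere 0 1" f] fin
  by (simp add: finite_circle_measure_def circle_borel_def cong: measurable_cong_sets)

lemma integrable_on_circle:
  fixes f :: "complex \<Rightarrow> complex"
  assumes f: "continuous_on (sphere 0 1) f"
  shows "integrable \<phi> f"
proof -
  interpret finite_measure \<phi> using fin by (simp add: finite_circle_measure_def)
  have "compact (f ` sphere 0 1)"
    by (rule compact_continuous_image[OF f]) simp
  then obtain B where "\<And>x. x \<in> sphere 0 1 \<Longrightarrow> norm (f x) \<le> B"
    by (meson bounded_iff compact_imp_bounded imageI)
  then show ?thesis
    by (intro integrable_const_bound[of _ B] measurable_on_circle[OF f])
      (auto simp: space_circle_measure)
qed

text \<open>On the unit circle conjugation is inversion, so the kernel factors as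
  \<open>cnj \<zeta> ^ i * \<zeta> ^ j\<close> and the double sum becomes a squared modulus under
  the integral.\<close>

lemma toeplitz_form:
  "(\<Sum>i<k. \<Sum>j<k. cnj (v i) * (fourier_coeff \<phi> (int i - int j) * v j)) =
     of_real (LINT \<zeta>|\<phi>. (cmod (\<Sum>j<k. v j * \<zeta> ^ j))\<^sup>2)"
proof -
  have int: "integrable \<phi> (\<lambda>\<zeta>. cnj (v i) * (\<zeta> powi (- (int i - int j)) * v j))" for i j
    by (intro integrable_on_circle continuous_intros) auto
  have eq: "(\<Sum>i<k. \<Sum>j<k. cnj (v i) * (\<zeta> powi (- (int i - int j)) * v j)) =
      of_real ((cmod (\<Sum>j<k. v j * \<zeta> ^ j))\<^sup>2)" if "\<zeta> \<in> space \<phi>" for \<zeta>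
  proof -
    have nz: "norm \<zeta> = 1" "\<zeta> \<noteq> 0" using that by (auto simp: space_circle_measure)
    have "\<zeta> * cnj \<zeta> = 1" using nz by (simp add: complex_norm_square[symmetric])
    then have cnj: "cnj \<zeta> = inverse \<zeta>" using nz by (simp add: field_simps)
    have "\<zeta> powi (- (int i - int j)) = cnj \<zeta> ^ i * \<zeta> ^ j" for i j
      using nz by (simp add: cnj power_int_diff power_int_minus field_simps)
    then have "(\<Sum>i<k. \<Sum>j<k. cnj (v i) * (\<zeta> powi (- (int i - int j)) * v j)) =
        (\<Sum>i<k. cnj (v i * \<zeta> ^ i)) * (\<Sum>j<k. v j * \<zeta> ^ j)"
      by (simp only: sum_product) (simp add: mult_ac)
    then show ?thesis
      unfolding complex_norm_square by (simp add: mult_ac)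
  qed
  have "(\<Sum>i<k. \<Sum>j<k. cnj (v i) * (fourier_coeff \<phi> (int i - int j) * v j)) =
      (\<Sum>i<k. \<Sum>j<k. (LINT \<zeta>|\<phi>. cnj (v i) * (\<zeta> powi (- (int i - int j)) * v j)))"
    by (simp add: fourier_coeff_def)
  also have "\<dots> = (LINT \<zeta>|\<phi>. (\<Sum>i<k. \<Sum>j<k. cnj (v i) * (\<zeta> powi (- (int i - int j)) * v j)))"
    by (subst integral_sum; (subst integral_sum)?) (use int in auto)
  also have "\<dots> = (LINT \<zeta>|\<phi>. of_real ((cmod (\<Sum>j<k. v j * \<zeta> ^ j))\<^sup>2))"
    by (rule Bochner_Integration.integral_cong) (use eq in auto)
  finally show ?thesis by (simp only: integral_complex_of_real)
qed

lemma toeplitz_det_nonneg: "toeplitz_det \<phi> k \<in> \<real>\<^sub>\<ge>\<^sub>0"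
  unfolding toeplitz_det_def
proof (rule det_psd_nonneg)
  fix v :: "complex vec" assume v: "v \<in> carrier_vec k"
  let ?A = "mat k k (\<lambda>(i, j). fourier_coeff \<phi> (int i - int j))"
  have "(\<Sum>i<k. cnj (v $ i) * (?A *\<^sub>v v) $ i) =
      (\<Sum>i<k. \<Sum>j<k. cnj (v $ i) * (fourier_coeff \<phi> (int i - int j) * v $ j))"
    using v by (intro sum.cong)
      (auto simp: scalar_prod_def sum_distrib_left atLeast0LessThan)
  then show "(\<Sum>i<k. cnj (v $ i) * (?A *\<^sub>v v) $ i) \<in> \<real>\<^sub>\<ge>\<^sub>0"
    by (simp add: toeplitz_form)
qed simp

lemma fourier_coeff_reflected: "fourier_coeff (reflected_measure \<phi>) j = fourier_coeff \<phi> (- j)"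
proof -
  have meas: "inverse \<in> measurable \<phi> circle_borel"
    unfolding circle_borel_def
    by (intro measurable_restrict_space2 measurable_on_circle continuous_intros)
      (auto simp: space_circle_measure norm_inverse)
  have "(\<lambda>\<zeta>. \<zeta> powi (- j)) \<in> borel_measurable circle_borel"
    unfolding circle_borel_def
    by (intro borel_measurable_continuous_on_restrict continuous_intros) auto
  then have "fourier_coeff (reflected_measure \<phi>) j = (LINT \<zeta>|\<phi>. inverse \<zeta> powi (- j))"
    unfolding fourier_coeff_def reflected_measure_def by (rule integral_distr[OF meas])
  then show ?thesis
    by (simp add: fourier_coeff_def power_int_minus power_int_inverse)
qed

end

section \<open>Square roots along the telescoping product\<close>

text \<open>The principal branch is not multiplicative in general (take \<open>x = y = -1\<close>);
  this is where positivity of the Toeplitz determinants enters.\<close>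

lemma csqrt_mult_nonneg:
  assumes "x \<in> \<real>\<^sub>\<ge>\<^sub>0" "y \<in> \<real>\<^sub>\<ge>\<^sub>0"
  shows "csqrt (x * y) = csqrt x * csqrt y"
  using assms by (auto simp: nonneg_Reals_def real_sqrt_mult simp flip: of_real_mult)

text \<open>Each factor equals \<open>csqrt (D k) / csqrt (D (k + 1))\<close>, so only the two ends
  survive.\<close>

lemma csqrt_telescope:
  fixes D :: "nat \<Rightarrow> complex"
  assumes "\<And>k. D k \<in> \<real>\<^sub>\<ge>\<^sub>0" and "\<And>k. p \<le> k \<Longrightarrow> k \<le> p + m \<Longrightarrow> D k \<noteq> 0"
  shows "(\<Prod>k=p..<p + m. 1 / csqrt (D k * D (k + 1)) * D k) = csqrt (D p) / csqrt (D (p + m))"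
  using assms(2)
proof (induction m)
  case (Suc m)
  have "1 / (csqrt d * csqrt d') * d = csqrt d / csqrt d'" for d d' :: complex
  proof -
    have "1 / (s * s') * (s * s) = s / s'" for s s' :: complex by simp
    from this[of "csqrt d" "csqrt d'"] show ?thesis
      using power2_csqrt[of d] by (simp only: power2_eq_square)
  qed
  with Suc show ?case
    by (simp add: csqrt_mult_nonneg assms(1))
qed simp

text \<open>Solves for the bordered determinant \<open>t\<close>, with \<open>d = D p\<close> and
  \<open>e = D (p + m)\<close>. Hence the radical pairs the indices \<open>n - m\<close> and
  \<open>n\<close>; the latter is \<open>n - m + 1\<close> exactly when
  \<open>m = 1\<close>.\<close>

lemma csqrt_scale_cancel:
  fixes d e t x :: complex
  assumes "d \<in> \<real>\<^sub>\<ge>\<^sub>0" "e \<in> \<real>\<^sub>\<ge>\<^sub>0" "d \<noteq> 0" "e \<noteq> 0"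
    and "t * (csqrt d / csqrt e) = d * x"
  shows "t = csqrt (d * e) * x"
proof -
  have "csqrt d * t = csqrt d * (csqrt d * csqrt e * x)"
    using assms(3-5) power2_csqrt[of d] by (simp add: field_simps power2_eq_square)
  then show ?thesis
    using assms(1-3) by (simp add: csqrt_mult_nonneg)
qed

theorem proposition1p10:
  fixes \<phi> :: "complex measure" and m n :: nat and z :: "nat \<Rightarrow> complex"
  assumes "finite_circle_measure \<phi>"
    and "1 \<le> m" and "m < n"
    and "\<And>k. n - m \<le> k \<Longrightarrow> k \<le> n \<Longrightarrow> toeplitz_det \<phi> k \<noteq> 0"
  shows "multi_bordered_det n m \<phi> z =
           csqrt (toeplitz_det \<phi> (n - m) * toeplitz_det \<phi> n) *
           Determinant.det (mat m m (\<lambda>(i, j). biorth_Q \<phi> (n - m + i) (z j)))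
       \<and> multi_bordered_det n m (reflected_measure \<phi>) z =
           csqrt (toeplitz_det \<phi> (n - m) * toeplitz_det \<phi> n) *
           Determinant.det (mat m m (\<lambda>(i, j). biorth_Q_hat \<phi> (n - m + i) (z j)))"
proof -
  define p where "p = n - m"
  have n: "n = p + m" using assms(3) by (simp add: p_def)
  define f where "f = fourier_coeff \<phi>"
  define D where "D = toeplitz_det \<phi>"
  define c where "c = (\<lambda>k. 1 / csqrt (D k * D (k + 1)))"
  have pos: "D k \<in> \<real>\<^sub>\<ge>\<^sub>0" for k
    unfolding D_def by (rule toeplitz_det_nonneg[OF assms(1)])
  have nz: "D k \<noteq> 0" if "p \<le> k" "k \<le> p + m" for k
    using assms(4) that by (simp add: D_def n)
  have tr: "det (mat k k (\<lambda>(i, j). g j i)) = det (mat k k (\<lambda>(i, j). g i j))"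
    for k and g :: "nat \<Rightarrow> nat \<Rightarrow> complex"
  proof -
    have "mat k k (\<lambda>(i, j). g j i) = transpose_mat (mat k k (\<lambda>(i, j). g i j))"
      by (rule eq_matI) auto
    then show ?thesis by (simp add: det_transpose[of _ k])
  qed
  \<comment> \<open>Only the leading minors of \<open>a\<close> matter here, so the same identity
    serves \<open>f (i - j)\<close> for \<open>Q\<close> and its transpose \<open>f (j - i)\<close>
    for the dual.\<close>
  have main: "det (mat n n (\<lambda>(i, j). if j < p then a j i else z (j - p) ^ i)) =
      csqrt (D p * D n) *
      det (mat m m (\<lambda>(i, j). c (p + i) *
        det (mat (p + i + 1) (p + i + 1) (\<lambda>(r, s). if r < p + i then a r s else z j ^ s))))"
    if a: "\<And>k. det (mat k k (\<lambda>(i, j). a i j)) = D k" for a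
  proof (rule csqrt_scale_cancel)
    show "det (mat n n (\<lambda>(i, j). if j < p then a j i else z (j - p) ^ i)) *
        (csqrt (D p) / csqrt (D n)) =
      D p * det (mat m m (\<lambda>(i, j). c (p + i) *
        det (mat (p + i + 1) (p + i + 1) (\<lambda>(r, s). if r < p + i then a r s else z j ^ s))))"
      using det_multi_bordered[of p m a "\<lambda>i j. z i ^ j" c] csqrt_telescope[of D p m, OF pos nz]
        tr[of n "\<lambda>i j. if i < p then a i j else z (i - p) ^ j"]
      by (simp add: a c_def n)
  qed (use pos nz[of p] nz[of n] n in auto)
  have D1: "det (mat k k (\<lambda>(i, j). f (int i - int j))) = D k" for k
    by (simp add: D_def toeplitz_det_def f_def)
  have D2: "det (mat k k (\<lambda>(i, j). f (int j - int i))) = D k" for k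
    using tr[of k "\<lambda>i j. f (int i - int j)"] D1 by simp
  \<comment> \<open>The dual is bordered by a last column; transposing gives a bordering row and
    reverses the index difference, as reflecting the measure does.\<close>
  have Qhat: "biorth_Q_hat \<phi> k x = c k *
      det (mat (k + 1) (k + 1) (\<lambda>(r, s). if r < k then f (int s - int r) else x ^ s))" for k x
    using tr[of "k + 1" "\<lambda>r s. if r < k then f (int s - int r) else x ^ s"]
    unfolding biorth_Q_hat_def c_def D_def f_def by simp
  show ?thesis
    using main[of "\<lambda>i j. f (int i - int j)", OF D1] main[of "\<lambda>i j. f (int j - int i)", OF D2]
    unfolding multi_bordered_det_def Qhat biorth_Q_def fourier_coeff_reflected[OF assms(1)]
      minus_diff_eq D_def[symmetric] f_def[symmetric] p_def[symmetric] c_def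
    by blast
qed

end
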